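(* Suppose we have a $C^1$ surface of revolution $S$ in standard position, and for some $\mu>0$, every plane of slope $m<\mu$ that cuts $S$ in a loop does so in a central loop. Then $S$ is quadric.
   Context: A $C^1$ loop in $\mathbf{R}^3$ is the image of a periodic $C^1$ mapping $\mathbf{R}\to\mathbf{R}^3$ whose derivative never vanishes. A loop in $\mathbf{R}^3$ is central if it has symmetry with respect to reflection through some point (that is, for some point $p$ the map $v\mapsto 2p-v$ preserves the loop); that point is called its center. A $C^1$ surface of revolution is a surface in $\mathbf{R}^3$ definable, after a rigid motion, as the locus $x^2+y^2=F(z)$, $|z|<q$, where $F$ is a strictly positive, differentiable profile function. When a surface of revolution has this description for some $q>0$ and some $F:(-q,q)\to(0,\infty)$, it is said to lie in standard position. It is allowed that $F(z)\to\infty$ as $|z|\to q$. The planes considered are those of the form $z=m_1x+m_2y+\beta$ with $m_1,m_2,\beta\in\mathbf{R}$; the slope of such a plane is $m=\sqrt{m_1^2+m_2^2}$. A surface of revolution in standard position is quadric if its profile function is quadratic, i.e. the surface is described by an equation $x^2+y^2=az^2+bz+c$ on $|z|<q$ with real constants $a,b,c$.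
   Formalization: "Cuts S in a loop" is read as: a connected component of the section is a loop (if the whole section must be one, F=1/(1-z^2), q=1 is a counterexample); and the profile F is taken continuously differentiable, since the claim fails for some F that are merely differentiable. *)

theory Defs
  imports "HOL-Analysis.Analysis"
begin

text \<open>A point of \<open>\<real>\<^sup>3\<close> is \<open>v :: real^3\<close>, with \<open>x = v$1\<close>, \<open>y = v$2\<close>, \<open>z = v$3\<close>.\<close>

text \<open>Self-intersections are permitted: only the derivative is required not to vanish.\<close>

definition C1_loop :: "(real^3) set \<Rightarrow> bool" where
  "C1_loop L \<longleftrightarrow>
     (\<exists>(\<gamma> :: real \<Rightarrow> real^3) T. T > 0 \<and> (\<forall>t. \<gamma> (t + T) = \<gamma> t) \<and>
        \<gamma> C1_differentiable_on UNIV \<and>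
        (\<forall>t. vector_derivative \<gamma> (at t) \<noteq> 0) \<and>
        L = range \<gamma>)"

definition central :: "(real^3) set \<Rightarrow> bool" where
  "central L \<longleftrightarrow> (\<exists>p. (\<lambda>v. 2 *\<^sub>R p - v) ` L = L)"

text \<open>
  The profile is required to be continuously differentiable, which is what makes the
  locus \<open>x\<^sup>2 + y\<^sup>2 = F z\<close> a \<open>C\<^sup>1\<close> surface. Values of \<open>F\<close> outside \<open>(-q, q)\<close> are irrelevant,
  and \<open>F\<close> may be unbounded on \<open>(-q, q)\<close>.
\<close>

definition C1_profile :: "real \<Rightarrow> (real \<Rightarrow> real) \<Rightarrow> bool" where
  "C1_profile q F \<longleftrightarrow>
     q > 0 \<and> (\<forall>z\<in>{-q<..<q}. F z > 0) \<and> F C1_differentiable_on {-q<..<q}"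

definition revolution_locus :: "real \<Rightarrow> (real \<Rightarrow> real) \<Rightarrow> (real^3) set" where
  "revolution_locus q F = {v. (v$1)\<^sup>2 + (v$2)\<^sup>2 = F (v$3) \<and> \<bar>v$3\<bar> < q}"

definition C1_surface_of_revolution_in_standard_position :: "(real^3) set \<Rightarrow> bool" where
  "C1_surface_of_revolution_in_standard_position S \<longleftrightarrow>
     (\<exists>q F. C1_profile q F \<and> S = revolution_locus q F)"

text \<open>The coefficient \<open>a\<close> may be zero, so cylinders and paraboloids of revolution count as quadric.\<close>

definition quadric :: "(real^3) set \<Rightarrow> bool" where
  "quadric S \<longleftrightarrow>
     (\<exists>q a b c. C1_profile q (\<lambda>z. a * z\<^sup>2 + b * z + c) \<and>
        S = revolution_locus q (\<lambda>z. a * z\<^sup>2 + b * z + c))"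

definition plane :: "real \<Rightarrow> real \<Rightarrow> real \<Rightarrow> (real^3) set" where
  "plane m1 m2 \<beta> = {v. v$3 = m1 * v$1 + m2 * v$2 + \<beta>}"

definition slope :: "real \<Rightarrow> real \<Rightarrow> real" where
  "slope m1 m2 = sqrt (m1\<^sup>2 + m2\<^sup>2)"

text \<open>
  The loop is a connected component of the section \<open>P \<inter> S\<close>, not necessarily all of it. When
  \<open>F\<close> is unbounded on \<open>(-q, q)\<close>, every plane of positive slope also meets \<open>S\<close> in unbounded
  pieces, so its full section is never a loop, however small the slope.
\<close>

definition cuts_in_loop :: "(real^3) set \<Rightarrow> (real^3) set \<Rightarrow> (real^3) set \<Rightarrow> bool" where
  "cuts_in_loop P S L \<longleftrightarrow> L \<in> components (P \<inter> S) \<and> C1_loop L"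

end

theory Submission
  imports Defs
begin

text \<open>
  Write the surface as \<open>x\<^sup>2 + y\<^sup>2 = F z\<close> with \<open>F = \<rho>\<^sup>2\<close>. A plane \<open>z = m x + \<beta>\<close> with small
  \<open>m > 0\<close> cuts the surface near height \<open>\<beta>\<close> in a loop that occupies the heights
  \<open>c - h \<le> z \<le> c + h\<close>, where \<open>c - h + m \<rho> (c - h) = \<beta> = c + h - m \<rho> (c + h)\<close>
  (\<open>capped_section_is_loop\<close>). On such a loop \<open>x = (z - \<beta>) / m\<close> and
  \<open>y\<^sup>2 = F z - (z - \<beta>)\<^sup>2 / m\<^sup>2\<close>. If the loop is central, its center lies at height \<open>c\<close> in the
  plane \<open>y = 0\<close>, so \<open>y\<^sup>2\<close> takes equal values at the heights \<open>c + t\<close> and \<open>c - t\<close>. This says that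
  \<open>F (c + t) - F (c - t)\<close> is a constant multiple of \<open>t\<close> for \<open>\<bar>t\<bar> \<le> h\<close>
  (\<open>central_capped_section_reflection\<close>).

  Near a given height \<open>z0\<close> one slope \<open>m\<close> serves for all \<open>c\<close>: the intermediate value theorem
  applied to \<open>m (\<rho> (c - h) + \<rho> (c + h)) = 2 h\<close> supplies \<open>h\<close>, and then \<open>\<beta>\<close>, for every \<open>c\<close>
  close to \<open>z0\<close>, and \<open>h\<close> is bounded below because \<open>\<rho>\<close> is. Hence all odd parts of \<open>F\<close>
  about points near \<open>z0\<close> are linear. Differentiating in \<open>t\<close> gives the trapezoidal identity
  \<open>F x - F y = (x - y) (F' x + F' y) / 2\<close>, whose solutions are the quadratic polynomials
  (\<open>quadratic_if_odd_parts_linear\<close>). So \<open>F\<close> is locally quadratic, and the coefficients agree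
  along the connected interval \<open>(-q, q)\<close>.
\<close>

section \<open>Loops cut by planes of small slope\<close>

lemma C1_inverse_on_interval:
  fixes w w' :: "real \<Rightarrow> real"
  assumes der: "\<And>z. a < z \<Longrightarrow> z < b \<Longrightarrow> (w has_real_derivative w' z) (at z)"
    and pos: "\<And>z. a < z \<Longrightarrow> z < b \<Longrightarrow> w' z > 0"
    and cont: "continuous_on {a<..<b} w'"
    and z12: "a < z1" "z1 \<le> z2" "z2 < b"
  obtains W W' where
    "\<And>y. w z1 \<le> y \<Longrightarrow> y \<le> w z2 \<Longrightarrow>
       (W has_real_derivative W' y) (at y) \<and> W' y > 0 \<and> z1 \<le> W y \<and> W y \<le> z2 \<and> w (W y) = y"
    "\<And>z. z1 \<le> z \<Longrightarrow> z \<le> z2 \<Longrightarrow> W (w z) = z"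
    "continuous_on {w z1..w z2} W'"
proof -
  have mono: "w x < w y" if "a < x" "x < y" "y < b" for x y
  proof (rule DERIV_pos_imp_increasing[OF \<open>x < y\<close>])
    fix z assume "x \<le> z" "z \<le> y"
    then show "\<exists>d. DERIV w z :> d \<and> d > 0"
      using der[of z] pos[of z] that by auto
  qed
  have inj: "x = y" if "w x = w y" "a < x" "x < b" "a < y" "y < b" for x y
    using mono[of x y] mono[of y x] that by (cases x y rule: linorder_cases) auto
  have isC: "isCont w z" if "a < z" "z < b" for z
    using der[OF that] by (rule DERIV_isCont)
  define W where "W = the_inv_into {a<..<b} w"
  have Ww: "W (w z) = z" if "a < z" "z < b" for z
    unfolding W_def by (rule the_inv_into_f_f) (use that inj in \<open>auto simp: inj_on_def\<close>)
  \<comment> \<open>The inverse is differentiated at the end points as well, so the interval is enlarged first.\<close>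
  define a1 b1 where "a1 = (a + z1) / 2" and "b1 = (z2 + b) / 2"
  have ab1: "a < a1" "a1 < z1" "z2 < b1" "b1 < b"
    using z12 by (auto simp: a1_def b1_def)
  have surj: "\<exists>z\<ge>x. z \<le> x' \<and> w z = y" if "w x \<le> y" "y \<le> w x'" "a < x" "x \<le> x'" "x' < b" for x x' y
    by (rule IVT) (use that isC in auto)
  have wa: "w a1 < w z1" "w z2 < w b1"
    using mono[of a1 z1] mono[of z2 b1] ab1 z12 by auto
  have main: "(W has_real_derivative inverse (w' (W y))) (at y) \<and> inverse (w' (W y)) > 0 \<and>
      z1 \<le> W y \<and> W y \<le> z2 \<and> w (W y) = y" if y: "w z1 \<le> y" "y \<le> w z2" for y
  proof -
    obtain z where z: "z1 \<le> z" "z \<le> z2" "w z = y"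
      using surj[of z1 y z2] y z12 by auto
    have Wy: "W y = z"
      using Ww[of z] z z12 by auto
    have contW: "isCont W (w z)"
      by (rule isCont_inverse_function2[where a = a1 and b = b1])
         (use z z12 ab1 Ww isC in auto)
    have "(W has_real_derivative inverse (w' z)) (at y)"
    proof (rule DERIV_inverse_function[where f = w and a = "w a1" and b = "w b1"])
      show "DERIV w (W y) :> w' z"
        using der[of z] z z12 Wy by auto
      show "w' z \<noteq> 0"
        using pos[of z] z z12 by auto
      show "w a1 < y" "y < w b1"
        using wa y by auto
      show "w (W x) = x" if x: "w a1 < x" "x < w b1" for x
      proof -
        obtain u where "a1 \<le> u" "u \<le> b1" "w u = x"
          using surj[of a1 x b1] x ab1 z12 by auto
        then show ?thesis
          using Ww[of u] ab1 by auto
      qed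
      show "isCont W y"
        using contW z by simp
    qed
    then show ?thesis
      using Wy z pos[of z] z12 by auto
  qed
  have "continuous_on {w z1..w z2} (\<lambda>y. inverse (w' (W y)))"
  proof (intro continuous_on_inverse continuous_on_compose2[OF cont])
    show "continuous_on {w z1..w z2} W"
      by (rule DERIV_continuous_on[where D = "\<lambda>y. inverse (w' (W y))"])
         (use main in \<open>auto intro: has_field_derivative_at_within\<close>)
    show "W ` {w z1..w z2} \<subseteq> {a<..<b}"
      using main z12 by fastforce
    show "\<forall>y\<in>{w z1..w z2}. w' (W y) \<noteq> 0"
      using main by fastforce
  qed
  then show thesis
    using that[of W "\<lambda>y. inverse (w' (W y))"] main Ww z12 by auto
qed

lemma clopen_connected_in_components:
  fixes A :: "'a::topological_space set"
  assumes "connected L" "L \<noteq> {}" "open U" "closed K" "L = A \<inter> U" "L = A \<inter> K"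
  shows "L \<in> components A"
  unfolding in_components_maximal
proof (intro conjI allI impI)
  fix D assume D: "D \<noteq> {} \<and> L \<subseteq> D \<and> D \<subseteq> A \<and> connected D"
  have "L = D \<inter> U" "L = D \<inter> K"
    using D assms(5,6) by auto
  then have "openin (top_of_set D) L" "closedin (top_of_set D) L"
    using assms(3,4) by (auto simp: openin_open closedin_closed)
  then show "D = L"
    using D assms(2) unfolding connected_clopen by blast
qed (use assms in auto)

text \<open>
  The part between the heights \<open>z1\<close> and \<open>z2\<close> of the section by the plane \<open>z = m x + \<beta>\<close>.
  By rotational symmetry, planes parallel to the \<open>y\<close>-axis are general enough.
\<close>

definition capped_section ::
    "real \<Rightarrow> (real \<Rightarrow> real) \<Rightarrow> real \<Rightarrow> real \<Rightarrow> real \<Rightarrow> real \<Rightarrow> (real^3) set" where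
  "capped_section q F m \<beta> z1 z2 =
     {v \<in> plane m 0 \<beta> \<inter> revolution_locus q F. z1 \<le> v$3 \<and> v$3 \<le> z2}"

text \<open>
  The hypothesis \<open>(z - \<beta>) \<rho>' z < \<rho> z\<close> makes \<open>(z - \<beta>) / (m \<rho> z)\<close> strictly increasing. On the
  section this quotient is \<open>x / \<rho> z\<close>, the cosine of the azimuth, so the azimuth \<open>t\<close> is a regular
  \<open>C\<^sup>1\<close> parameter of the loop, with the height \<open>Z t\<close> a \<open>C\<^sup>1\<close> function of \<open>cos t\<close>.
\<close>

lemma capped_section_is_loop:
  fixes \<rho> \<rho>' F :: "real \<Rightarrow> real"
  assumes der: "\<And>z. a < z \<Longrightarrow> z < b \<Longrightarrow> (\<rho> has_real_derivative \<rho>' z) (at z)"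
    and cont: "continuous_on {a<..<b} \<rho>'"
    and pos: "\<And>z. a < z \<Longrightarrow> z < b \<Longrightarrow> \<rho> z > 0"
    and flat: "\<And>z. a < z \<Longrightarrow> z < b \<Longrightarrow> (z - \<beta>) * \<rho>' z < \<rho> z"
    and F: "\<And>z. a < z \<Longrightarrow> z < b \<Longrightarrow> F z = (\<rho> z)\<^sup>2 \<and> \<bar>z\<bar> < q"
    and m: "m > 0"
    and z12: "a < z1" "z1 < z2" "z2 < b"
    and ends: "z1 + m * \<rho> z1 = \<beta>" "z2 - m * \<rho> z2 = \<beta>"
  shows "cuts_in_loop (plane m 0 \<beta>) (revolution_locus q F) (capped_section q F m \<beta> z1 z2)"
proof -
  let ?L = "capped_section q F m \<beta> z1 z2"
  let ?A = "plane m 0 \<beta> \<inter> revolution_locus q F"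
  \<comment> \<open>\<open>w z\<close> is the cosine of the azimuth of a section point at height \<open>z\<close>.\<close>
  define w where "w = (\<lambda>z. (z - \<beta>) / (m * \<rho> z))"
  define w' where "w' = (\<lambda>z. (\<rho> z - (z - \<beta>) * \<rho>' z) / (m * (\<rho> z)\<^sup>2))"
  have contr: "continuous_on {a<..<b} \<rho>"
    by (rule DERIV_continuous_on[where D = \<rho>']) (auto intro: has_field_derivative_at_within der)
  have dw: "(w has_real_derivative w' z) (at z)" if "a < z" "z < b" for z
    unfolding w_def w'_def
    by (rule derivative_eq_intros der[OF that] refl)+
       (use pos[OF that] m in \<open>auto simp: field_simps power2_eq_square\<close>)
  have w'pos: "w' z > 0" if "a < z" "z < b" for z
    unfolding w'_def using flat[OF that] pos[OF that] m by simp
  have w'cont: "continuous_on {a<..<b} w'"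
    unfolding w'_def by (intro continuous_intros cont contr) (use pos m in force)
  have mono: "w x < w y" if "a < x" "x < y" "y < b" for x y
  proof (rule DERIV_pos_imp_increasing[OF \<open>x < y\<close>])
    fix z assume "x \<le> z" "z \<le> y"
    then show "\<exists>d. DERIV w z :> d \<and> d > 0"
      using dw[of z] w'pos[of z] that by auto
  qed
  have w1: "w z1 = -1" "w z2 = 1"
  proof -
    have "z1 - \<beta> = - (m * \<rho> z1)" "z2 - \<beta> = m * \<rho> z2" "m * \<rho> z1 \<noteq> 0" "m * \<rho> z2 \<noteq> 0"
      using ends m pos[of z1] pos[of z2] z12 by auto
    then show "w z1 = -1" "w z2 = 1"
      by (auto simp: w_def)
  qed
  obtain W W' where W: "\<And>y. w z1 \<le> y \<Longrightarrow> y \<le> w z2 \<Longrightarrow> (W has_real_derivative W' y) (at y) \<and>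
       W' y > 0 \<and> z1 \<le> W y \<and> W y \<le> z2 \<and> w (W y) = y"
    and Ww: "\<And>z. z1 \<le> z \<Longrightarrow> z \<le> z2 \<Longrightarrow> W (w z) = z"
    and W'cont: "continuous_on {w z1..w z2} W'"
    using C1_inverse_on_interval[OF dw w'pos w'cont z12(1) less_imp_le[OF z12(2)] z12(3)]
    by metis
  define Z where "Z = (\<lambda>t. W (cos t))"
  define Z' where "Z' = (\<lambda>t. W' (cos t) * - sin t)"
  have Wc: "(W has_real_derivative W' (cos t)) (at (cos t))" "W' (cos t) > 0"
      "z1 \<le> Z t" "Z t \<le> z2" "w (Z t) = cos t" for t
    using W[of "cos t"] w1 by (auto simp: Z_def)
  have Zab: "a < Z t" "Z t < b" for t
    using Wc(3,4)[of t] z12 by auto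
  have dZ: "(Z has_real_derivative Z' t) (at t)" for t
    unfolding Z_def Z'_def
    by (rule DERIV_chain2[where f = W and g = cos]) (rule Wc(1) DERIV_cos)+
  have Zeq: "Z t - \<beta> = m * \<rho> (Z t) * cos t" for t
    using Wc(5)[of t] pos[OF Zab[of t]] m by (simp add: w_def field_simps)
  \<comment> \<open>By \<open>Zeq\<close> the first coordinate is also \<open>\<rho> (Z t) * cos t\<close>.\<close>
  define \<gamma> :: "real \<Rightarrow> real^3" where "\<gamma> = (\<lambda>t. ((Z t - \<beta>) / m) *\<^sub>R axis 1 1 +
      (\<rho> (Z t) * sin t) *\<^sub>R axis 2 1 + Z t *\<^sub>R axis 3 1)"
  define \<gamma>' :: "real \<Rightarrow> real^3" where "\<gamma>' = (\<lambda>t. (Z' t / m) *\<^sub>R axis 1 1 +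
      (\<rho>' (Z t) * Z' t * sin t + \<rho> (Z t) * cos t) *\<^sub>R axis 2 1 + Z' t *\<^sub>R axis 3 1)"
  have comp: "\<gamma> t $ 1 = (Z t - \<beta>) / m" "\<gamma> t $ 2 = \<rho> (Z t) * sin t" "\<gamma> t $ 3 = Z t" for t
    by (simp_all add: \<gamma>_def axis_def)
  have comp': "\<gamma>' t $ 2 = \<rho>' (Z t) * Z' t * sin t + \<rho> (Z t) * cos t" "\<gamma>' t $ 3 = Z' t" for t
    by (simp_all add: \<gamma>'_def axis_def)
  have d\<gamma>: "(\<gamma> has_vector_derivative \<gamma>' t) (at t)" for t
  proof -
    have "((\<lambda>t. \<rho> (Z t)) has_real_derivative \<rho>' (Z t) * Z' t) (at t)"
      by (rule DERIV_chain2[where f = \<rho> and g = Z]) (rule der Zab dZ)+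
    from this dZ[of t] show ?thesis
      unfolding \<gamma>_def \<gamma>'_def
      by (auto intro!: derivative_eq_intros simp: m[THEN less_imp_neq, symmetric])
  qed
  have Zcont: "continuous_on UNIV Z"
    by (rule DERIV_continuous_on[where D = Z']) (use dZ in auto)
  have Z'cont: "continuous_on UNIV Z'"
    unfolding Z'_def
    by (intro continuous_intros continuous_on_compose2[OF W'cont]) (use w1 in auto)
  have "continuous_on UNIV (\<lambda>t. \<rho> (Z t))" "continuous_on UNIV (\<lambda>t. \<rho>' (Z t))"
    by (rule continuous_on_compose2[OF contr Zcont] continuous_on_compose2[OF cont Zcont];
        use Zab in auto)+
  then have "continuous_on UNIV \<gamma>'"
    unfolding \<gamma>'_def using m by (intro continuous_intros Z'cont) auto
  then have C1: "\<gamma> C1_differentiable_on UNIV"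
    unfolding C1_differentiable_on_def using d\<gamma> by blast
  \<comment> \<open>Where the height is stationary, \<open>sin t = 0\<close>, and then \<open>y\<close> moves with speed \<open>\<rho>\<close>.\<close>
  have nz: "vector_derivative \<gamma> (at t) \<noteq> 0" for t
  proof
    assume "vector_derivative \<gamma> (at t) = 0"
    then have g0: "\<gamma>' t = 0"
      using vector_derivative_at[OF d\<gamma>] by simp
    then have "Z' t = 0"
      using comp'(2)[of t] by simp
    then have "sin t = 0" "\<rho> (Z t) * cos t = 0"
      using Wc(2)[of t] comp'(1)[of t] g0 by (auto simp: Z'_def)
    then show False
      using pos[OF Zab[of t]] sin_cos_squared_add[of t] by auto
  qed
  have range: "?L = range \<gamma>"
  proof (intro equalityI subsetI)
    fix v assume "v \<in> ?L"
    then have v: "v$3 = m * v$1 + \<beta>" "(v$1)\<^sup>2 + (v$2)\<^sup>2 = F (v$3)" "z1 \<le> v$3" "v$3 \<le> z2"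
      by (auto simp: capped_section_def plane_def revolution_locus_def)
    have vab: "a < v$3" "v$3 < b"
      using v z12 by auto
    note r = pos[OF vab]
    have "(v$1 / \<rho> (v$3))\<^sup>2 + (v$2 / \<rho> (v$3))\<^sup>2 = 1"
      using v(2) F[OF vab] r by (simp add: power_divide flip: add_divide_distrib)
    then obtain t where t: "v$1 / \<rho> (v$3) = cos t" "v$2 / \<rho> (v$3) = sin t"
      by (rule sincos_total_2pi) auto
    have "w (v$3) = cos t"
      unfolding t(1)[symmetric] w_def using m v(1) by auto
    then have "Z t = v$3"
      using Ww[OF v(3,4)] by (simp add: Z_def)
    then have "v = \<gamma> t"
      using v(1) t(2) r m by (simp add: vec_eq_iff forall_3 comp field_simps)
    then show "v \<in> range \<gamma>"
      by auto
  next
    fix v assume "v \<in> range \<gamma>"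
    then obtain t where t: "v = \<gamma> t"
      by auto
    have "(Z t - \<beta>) / m = \<rho> (Z t) * cos t"
      using Zeq[of t] m by simp
    then have "((Z t - \<beta>) / m)\<^sup>2 + (\<rho> (Z t) * sin t)\<^sup>2 = F (Z t)"
      using F[OF Zab[of t]] sin_cos_squared_add2[of t]
      by (simp add: power_mult_distrib flip: distrib_left)
    then show "v \<in> ?L"
      using F[OF Zab[of t]] Wc(3,4)[of t] m
      by (simp add: t capped_section_def plane_def revolution_locus_def comp)
  qed
  have "C1_loop ?L"
    unfolding C1_loop_def
    by (rule exI[of _ \<gamma>], rule exI[of _ "2 * pi"])
       (use C1 nz range in \<open>auto simp: \<gamma>_def Z_def\<close>)
  moreover have "?L \<in> components ?A"
  proof (rule clopen_connected_in_components)
    have "continuous_on UNIV \<gamma>"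
      by (metis C1 C1_differentiable_imp_continuous_on)
    then show "connected ?L"
      unfolding range by (rule connected_continuous_image) auto
    show "?L \<noteq> {}"
      unfolding range by auto
    show "open {v :: real^3. a < v$3 \<and> v$3 < b}"
      by (intro open_Collect_conj open_Collect_less continuous_intros)
    show "closed {v :: real^3. z1 \<le> v$3 \<and> v$3 \<le> z2}"
      by (intro closed_Collect_conj closed_Collect_le continuous_intros)
    show "?L = ?A \<inter> {v. z1 \<le> v$3 \<and> v$3 \<le> z2}"
      by (auto simp: capped_section_def)
    \<comment> \<open>No section point in \<open>a < z < b\<close> lies outside \<open>z1 \<le> z \<le> z2\<close>, since \<open>\<bar>w\<bar> > 1\<close> there.\<close>
    have "z1 \<le> v$3 \<and> v$3 \<le> z2" if v: "v \<in> ?A" "a < v$3" "v$3 < b" for v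
    proof -
      note r = pos[OF v(2,3)]
      have v1: "v$3 = m * v$1 + \<beta>" "(v$1)\<^sup>2 + (v$2)\<^sup>2 = (\<rho> (v$3))\<^sup>2"
        using v F[of "v$3"] by (auto simp: plane_def revolution_locus_def)
      have "(v$1)\<^sup>2 \<le> (\<rho> (v$3))\<^sup>2"
        using v1(2) zero_le_power2[of "v$2"] by linarith
      then have "\<bar>v$1\<bar> \<le> \<rho> (v$3)"
        using r abs_le_square_iff[of "v$1" "\<rho> (v$3)"] by auto
      moreover have "w (v$3) = v$1 / \<rho> (v$3)"
        unfolding w_def using m v1(1) by auto
      ultimately have "-1 \<le> w (v$3)" "w (v$3) \<le> 1"
        using r by (simp_all add: pos_le_divide_eq pos_divide_le_eq abs_le_iff)
      then show ?thesis
        using mono[of "v$3" z1] mono[of z2 "v$3"] w1 v z12 by (auto simp: not_less[symmetric])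
    qed
    then show "?L = ?A \<inter> {v. a < v$3 \<and> v$3 < b}"
      using z12 by (auto simp: capped_section_def)
  qed
  ultimately show ?thesis
    by (simp add: cuts_in_loop_def)
qed

section \<open>The odd part of the profile about the height of a center\<close>

text \<open>
  The conditions on \<open>F (c - h)\<close> and \<open>F (c + h)\<close> say that the section meets these heights
  only in \<open>y = 0\<close>; by connectedness it then reaches every height in between.
\<close>

lemma central_capped_section_reflection:
  fixes F :: "real \<Rightarrow> real"
  assumes central: "central (capped_section q F m \<beta> (c - h) (c + h))"
    and conn: "connected (capped_section q F m \<beta> (c - h) (c + h))"
    and m: "m > 0" and h: "h \<ge> 0"
    and q: "\<bar>c - h\<bar> < q" "\<bar>c + h\<bar> < q"
    and low: "(c - h - \<beta>)\<^sup>2 = m\<^sup>2 * F (c - h)"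
    and high: "(c + h - \<beta>)\<^sup>2 = m\<^sup>2 * F (c + h)"
    and t: "\<bar>t\<bar> \<le> h"
  shows "F (c + t) - F (c - t) = 4 * (c - \<beta>) / m\<^sup>2 * t"
proof -
  let ?L = "capped_section q F m \<beta> (c - h) (c + h)"
  obtain p where p: "(\<lambda>v. 2 *\<^sub>R p - v) ` ?L = ?L"
    using central unfolding central_def by blast
  have mem: "v \<in> ?L \<longleftrightarrow> v$1 = (v$3 - \<beta>) / m \<and> (v$2)\<^sup>2 = F (v$3) - ((v$3 - \<beta>) / m)\<^sup>2 \<and>
      c - h \<le> v$3 \<and> v$3 \<le> c + h" for v
  proof -
    have q': "\<bar>v$3\<bar> < q" if "c - h \<le> v$3" "v$3 \<le> c + h"
      using q that by linarith
    have "v$3 = m * v$1 + 0 * v$2 + \<beta> \<longleftrightarrow> v$1 = (v$3 - \<beta>) / m"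
      using m by (auto simp: field_simps)
    moreover have "(v$1)\<^sup>2 + (v$2)\<^sup>2 = F (v$3) \<longleftrightarrow> (v$2)\<^sup>2 = F (v$3) - (v$1)\<^sup>2"
      by linarith
    ultimately show ?thesis
      using q' unfolding capped_section_def plane_def revolution_locus_def mem_Collect_eq Int_iff
      by metis
  qed
  have refl: "2 *\<^sub>R p - v \<in> ?L" if "v \<in> ?L" for v
    using p that by blast
  have ex: "\<exists>v\<in>?L. v$3 = z" if z: "c - h \<le> z" "z \<le> c + h" for z
  proof -
    have end_point: "\<zeta> \<in> (\<lambda>v. v$3) ` ?L"
      if "(\<zeta> - \<beta>)\<^sup>2 = m\<^sup>2 * F \<zeta>" "c - h \<le> \<zeta>" "\<zeta> \<le> c + h" for \<zeta>
      using that m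
      by (intro image_eqI[of _ _ "vector [(\<zeta> - \<beta>) / m, 0, \<zeta>]"])
         (simp_all add: mem vector_3 power_divide)
    have "connected ((\<lambda>v. v$3) ` ?L)"
      by (intro connected_continuous_image conn continuous_intros)
    then have "z \<in> (\<lambda>v. v$3) ` ?L"
      by (rule connectedD_interval[OF _ end_point[OF low] end_point[OF high] z]) (use h in auto)
    then show ?thesis
      by blast
  qed
  obtain v1 v2 where v1: "v1 \<in> ?L" "v1$3 = c - h" and v2: "v2 \<in> ?L" "v2$3 = c + h"
    using ex[of "c - h"] ex[of "c + h"] h by auto
  have p3: "p$3 = c"
    using refl[OF v1(1)] refl[OF v2(1)] v1(2) v2(2) by (auto simp: mem)
  have p1: "p$1 = (c - \<beta>) / m"
  proof -
    have "2 * p$1 - v1$1 = (2 * c - (c - h) - \<beta>) / m" "v1$1 = (c - h - \<beta>) / m"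
      using refl[OF v1(1)] v1 p3 by (auto simp: mem)
    then have "2 * p$1 = (2 * c - (c - h) - \<beta>) / m + (c - h - \<beta>) / m"
      by linarith
    also have "\<dots> = 2 * ((c - \<beta>) / m)"
      using m by (simp add: field_simps)
    finally show ?thesis
      by linarith
  qed
  \<comment> \<open>The lowest point lies in \<open>y = 0\<close>; it is antipodal both to a highest point
    and to the mirror image of that point in \<open>y = 0\<close>.\<close>
  have p2: "p$2 = 0"
  proof -
    define u where "u = vector [v2$1, - (v2$2), v2$3] - (0 :: real^3)"
    have "u \<in> ?L" "u$2 = - (v2$2)" "u$3 = c + h"
      using v2 by (auto simp: mem u_def)
    moreover have "x$2 = 0" if "x \<in> ?L" "x$3 = c - h" for x
      using that low m by (auto simp: mem power_divide)
    moreover have "(2 *\<^sub>R p - v2)$3 = c - h" "(2 *\<^sub>R p - u)$3 = c - h"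
      using v2(2) p3 \<open>u$3 = c + h\<close> by simp_all
    ultimately have "(2 *\<^sub>R p - v2)$2 = 0" "(2 *\<^sub>R p - u)$2 = 0"
      using refl v2(1) by blast+
    then show ?thesis
      using \<open>u$2 = - (v2$2)\<close> by simp
  qed
  obtain v where v: "v \<in> ?L" "v$3 = c + t"
    using ex[of "c + t"] t unfolding abs_le_iff by force
  have "(v$2)\<^sup>2 = F (c + t) - ((c + t - \<beta>) / m)\<^sup>2"
    using v by (simp add: mem)
  moreover have "(v$2)\<^sup>2 = F (c - t) - ((c - t - \<beta>) / m)\<^sup>2"
    using refl[OF v(1)] v(2) p2 p3 by (simp add: mem)
  ultimately have "F (c + t) - F (c - t) = ((c + t - \<beta>) / m)\<^sup>2 - ((c - t - \<beta>) / m)\<^sup>2"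
    by linarith
  also have "\<dots> = 4 * (c - \<beta>) / m\<^sup>2 * t"
    using m by (simp add: power2_eq_square field_simps)
  finally show ?thesis .
qed

section \<open>Functions with linear odd parts\<close>

text \<open>
  The base point \<open>y\<close> is kept at one end: for \<open>x > y\<close> the trapezoidal identity says that
  \<open>F x - F y - F' y * (x - y)\<close> divided by \<open>(x - y)\<^sup>2\<close> has derivative zero, which avoids
  matching solutions on the two sides of \<open>y\<close>.
\<close>

lemma quadratic_if_odd_parts_linear:
  fixes F F' :: "real \<Rightarrow> real"
  assumes der: "\<And>z. a < z \<Longrightarrow> z < b \<Longrightarrow> (F has_real_derivative F' z) (at z)"
    and odd: "\<And>c. a < c \<Longrightarrow> c < b \<Longrightarrow>
      \<exists>K. \<forall>t. 0 \<le> t \<longrightarrow> a < c - t \<longrightarrow> c + t < b \<longrightarrow> F (c + t) - F (c - t) = K * t"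
    and y: "a < y" "y < b"
  obtains A B C where "\<And>z. y < z \<Longrightarrow> z < b \<Longrightarrow> F z = A * z\<^sup>2 + B * z + C"
proof -
  \<comment> \<open>With \<open>c\<close> the midpoint, \<open>K\<close> equals both \<open>F' x + F' y\<close> and \<open>2 (F x - F y) / (x - y)\<close>.\<close>
  have trap: "F x - F y = (x - y) * (F' x + F' y) / 2" if x: "y < x" "x < b" for x
  proof -
    define c t0 where "c = (x + y) / 2" and "t0 = (x - y) / 2"
    have ct: "c + t0 = x" "c - t0 = y" "0 < t0" "a < c" "c < b"
      using x y by (auto simp: c_def t0_def field_simps)
    obtain K where K: "\<And>t. 0 \<le> t \<Longrightarrow> a < c - t \<Longrightarrow> c + t < b \<Longrightarrow> F (c + t) - F (c - t) = K * t"
      using odd[OF ct(4,5)] by blast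
    have "((\<lambda>t. F (c + t)) has_real_derivative F' x * 1) (at t0)"
      by (rule DERIV_chain2[where f = F and g = "\<lambda>t. c + t"])
         (use der[of x] x y ct in \<open>auto intro!: derivative_eq_intros\<close>)
    moreover have "((\<lambda>t. F (c - t)) has_real_derivative F' y * (-1)) (at t0)"
      by (rule DERIV_chain2[where f = F and g = "\<lambda>t. c - t"])
         (use der[of y] x y ct in \<open>auto intro!: derivative_eq_intros\<close>)
    ultimately have "((\<lambda>t. F (c + t) - F (c - t)) has_real_derivative F' x * 1 - F' y * (-1)) (at t0)"
      by (rule DERIV_diff)
    moreover have "((\<lambda>t. F (c + t) - F (c - t)) has_real_derivative K) (at t0)"
    proof (rule has_field_derivative_transform_within_open)
      show "((\<lambda>t. K * t) has_real_derivative K) (at t0)"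
        by (auto intro!: derivative_eq_intros)
      show "open {0<..<min (c - a) (b - c)}" "t0 \<in> {0<..<min (c - a) (b - c)}"
        using ct x y by auto
      show "K * t = F (c + t) - F (c - t)" if "t \<in> {0<..<min (c - a) (b - c)}" for t
        using K[of t] that by auto
    qed
    ultimately have "F' x * 1 - F' y * (-1) = K"
      by (rule DERIV_unique)
    moreover have "F x - F y = K * t0"
      using K[of t0] ct x y by auto
    ultimately show ?thesis
      by (simp add: t0_def)
  qed
  define G where "G = (\<lambda>x. (F x - F y - F' y * (x - y)) / (x - y)\<^sup>2)"
  have dG: "(G has_real_derivative 0) (at x)" if x: "x \<in> {y<..<b}" for x
  proof -
    have "((\<lambda>x. F x - F y - F' y * (x - y)) has_real_derivative F' x - F' y) (at x)"
      using der[of x] x y by (auto intro!: derivative_eq_intros)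
    moreover have "((\<lambda>x. (x - y)\<^sup>2) has_real_derivative 2 * (x - y)) (at x)"
      by (auto intro!: derivative_eq_intros)
    ultimately have "(G has_real_derivative ((F' x - F' y) * (x - y)\<^sup>2 -
        (F x - F y - F' y * (x - y)) * (2 * (x - y))) / ((x - y)\<^sup>2 * (x - y)\<^sup>2)) (at x)"
      unfolding G_def by (rule DERIV_divide) (use x in auto)
    moreover have "F x = F y + (x - y) * (F' x + F' y) / 2"
      using trap[of x] x by auto
    ultimately show ?thesis
      by (simp add: field_simps power2_eq_square)
  qed
  obtain A where A: "\<And>x. x \<in> {y<..<b} \<Longrightarrow> G x = A"
    using has_field_derivative_zero_constant[of "{y<..<b}" G] dG has_field_derivative_at_within
    by (metis convex_real_interval(8))
  have "F z = A * z\<^sup>2 + (F' y - 2 * A * y) * z + (F y - F' y * y + A * y\<^sup>2)"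
    if z: "y < z" "z < b" for z
  proof -
    have "F z - F y - F' y * (z - y) = A * (z - y)\<^sup>2"
      using A[of z] z by (simp add: G_def divide_eq_eq)
    then show ?thesis
      by (simp add: power2_eq_square algebra_simps)
  qed
  then show thesis
    by (rule that)
qed

lemma quadratic_coeffs_unique:
  fixes A B C A' B' C' :: real
  assumes "\<forall>\<^sub>F z in nhds z0. A * z\<^sup>2 + B * z + C = A' * z\<^sup>2 + B' * z + C'"
  shows "A = A' \<and> B = B' \<and> C = C'"
proof -
  obtain e where e: "e > 0"
    and eq: "\<And>z. dist z z0 < e \<Longrightarrow> A * z\<^sup>2 + B * z + C = A' * z\<^sup>2 + B' * z + C'"
    using assms unfolding eventually_nhds_metric by blast
  define d where "d = e / 2"
  have d: "d > 0"
    using e by (simp add: d_def)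
  define \<alpha> \<beta> \<gamma> where "\<alpha> = A - A'" and "\<beta> = B - B'" and "\<gamma> = C - C'"
  have z: "\<alpha> * z\<^sup>2 + \<beta> * z + \<gamma> = 0" if "dist z z0 < e" for z
    using eq[OF that] by (simp add: \<alpha>_def \<beta>_def \<gamma>_def algebra_simps)
  have 1: "\<alpha> * (z0 + d)\<^sup>2 + \<beta> * (z0 + d) + \<gamma> = 0" "\<alpha> * (z0 - d)\<^sup>2 + \<beta> * (z0 - d) + \<gamma> = 0"
    "\<alpha> * z0\<^sup>2 + \<beta> * z0 + \<gamma> = 0"
    using e by (auto intro!: z simp: d_def dist_real_def)
  have "2 * \<alpha> * d\<^sup>2 = (\<alpha> * (z0 + d)\<^sup>2 + \<beta> * (z0 + d) + \<gamma>) +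
      (\<alpha> * (z0 - d)\<^sup>2 + \<beta> * (z0 - d) + \<gamma>) - 2 * (\<alpha> * z0\<^sup>2 + \<beta> * z0 + \<gamma>)"
    by (simp add: power2_eq_square algebra_simps)
  then have \<alpha>: "\<alpha> = 0"
    using 1 d by simp
  then have "\<beta> * d = 0"
    using 1 by (simp add: algebra_simps)
  then have "\<beta> = 0"
    using d by simp
  then show ?thesis
    using \<alpha> 1(3) by (simp add: \<alpha>_def \<beta>_def \<gamma>_def)
qed

lemma locally_quadratic_imp_quadratic:
  fixes F :: "real \<Rightarrow> real"
  assumes conn: "connected I"
    and loc: "\<And>z0. z0 \<in> I \<Longrightarrow> \<exists>A B C. \<forall>\<^sub>F z in nhds z0. F z = A * z\<^sup>2 + B * z + C"
  obtains A B C where "\<And>z. z \<in> I \<Longrightarrow> F z = A * z\<^sup>2 + B * z + C"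
proof (cases "I = {}")
  case False
  obtain A B C where ABC:
    "\<And>z0. z0 \<in> I \<Longrightarrow> \<forall>\<^sub>F z in nhds z0. F z = A z0 * z\<^sup>2 + B z0 * z + C z0"
    using loc by metis
  define T where "T = (\<lambda>z. (A z, B z, C z))"
  have local_const: "\<forall>\<^sub>F z in nhds z0. z \<in> I \<longrightarrow> T z0 = T z" if z0: "z0 \<in> I" for z0
  proof -
    have "\<forall>\<^sub>F z1 in nhds z0. \<forall>\<^sub>F z in nhds z1. F z = A z0 * z\<^sup>2 + B z0 * z + C z0"
      using ABC[OF z0] by (simp add: eventually_eventually)
    then show ?thesis
    proof eventually_elim
      case (elim z1)
      show ?case
      proof
        assume z1: "z1 \<in> I"
        have "\<forall>\<^sub>F z in nhds z1. A z0 * z\<^sup>2 + B z0 * z + C z0 = A z1 * z\<^sup>2 + B z1 * z + C z1"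
          using elim ABC[OF z1] by eventually_elim simp
        then show "T z0 = T z1"
          using quadratic_coeffs_unique unfolding T_def by blast
      qed
    qed
  qed
  have "\<forall>z0\<in>I. \<forall>\<^sub>F z in at z0 within I. T z0 = T z"
    unfolding eventually_at_filter
    using local_const by (blast intro: eventually_mono)
  then have const: "T z = T z0" if "z \<in> I" "z0 \<in> I" for z z0
    using connected_local_const[OF conn that] by blast
  from False obtain z0 where z0: "z0 \<in> I"
    by blast
  have "F z = A z0 * z\<^sup>2 + B z0 * z + C z0" if z: "z \<in> I" for z
    using eventually_nhds_x_imp_x[OF ABC[OF z]] const[OF z z0] by (simp add: T_def)
  then show thesis
    by (rule that)
qed (use that in auto)

section \<open>Central sections force a quadratic profile\<close>

lemma central_sections_imp_locally_quadratic:
  fixes F :: "real \<Rightarrow> real"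
  assumes profile: "C1_profile q F" and \<mu>: "\<mu> > 0"
    and central: "\<And>m \<beta> L. 0 < m \<Longrightarrow> m < \<mu> \<Longrightarrow>
      cuts_in_loop (plane m 0 \<beta>) (revolution_locus q F) L \<Longrightarrow> central L"
    and z0: "z0 \<in> {-q<..<q}"
  shows "\<exists>A B C. \<forall>\<^sub>F z in nhds z0. F z = A * z\<^sup>2 + B * z + C"
proof -
  have Fpos: "\<And>z. z \<in> {-q<..<q} \<Longrightarrow> F z > 0"
    using profile by (simp add: C1_profile_def)
  obtain F' where F': "\<And>z. z \<in> {-q<..<q} \<Longrightarrow> (F has_real_derivative F' z) (at z)"
    and F'cont: "continuous_on {-q<..<q} F'"
    using profile
    unfolding C1_profile_def C1_differentiable_on_def has_real_derivative_iff_has_vector_derivative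
    by blast
  define \<rho> \<rho>' where "\<rho> = (\<lambda>z. sqrt (F z))" and "\<rho>' = (\<lambda>z. F' z / (2 * sqrt (F z)))"
  have \<rho>pos: "\<rho> z > 0" and \<rho>sq: "(\<rho> z)\<^sup>2 = F z"
    and d\<rho>: "(\<rho> has_real_derivative \<rho>' z) (at z)" if "z \<in> {-q<..<q}" for z
  proof -
    show "\<rho> z > 0" "(\<rho> z)\<^sup>2 = F z"
      using Fpos[OF that] by (simp_all add: \<rho>_def)
    have "(\<rho> has_real_derivative inverse (sqrt (F z)) / 2 * F' z) (at z)"
      unfolding \<rho>_def
      by (rule DERIV_chain2[where f = sqrt and g = F, OF DERIV_real_sqrt F'[OF that]])
         (rule Fpos[OF that])
    then show "(\<rho> has_real_derivative \<rho>' z) (at z)"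
      by (simp add: \<rho>'_def field_simps)
  qed
  have \<rho>cont: "continuous_on {-q<..<q} \<rho>"
    by (rule DERIV_continuous_on[where D = \<rho>']) (rule has_field_derivative_at_within[OF d\<rho>])
  have \<rho>'cont: "continuous_on {-q<..<q} \<rho>'"
    using continuous_on_divide[OF F'cont continuous_on_mult_left[OF \<rho>cont, of 2]] \<rho>pos
    by (force simp: \<rho>'_def \<rho>_def)
  define k N where "k = \<rho> z0" and "N = \<bar>\<rho>' z0\<bar> + 1"
  have k: "k > 0" and N: "N > 0"
    using \<rho>pos[OF z0] by (auto simp: k_def N_def)
  have "\<forall>\<^sub>F z in nhds z0. z \<in> {-q<..<q} \<and> k / 2 < \<rho> z \<and> \<rho> z < 2 * k \<and> \<bar>\<rho>' z\<bar> < N"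
  proof -
    have "isCont \<rho> z0" "isCont \<rho>' z0"
      using \<rho>cont \<rho>'cont z0 by (auto simp: continuous_on_eq_continuous_at)
    then have "(\<rho> \<longlongrightarrow> k) (nhds z0)" "((\<lambda>z. \<bar>\<rho>' z\<bar>) \<longlongrightarrow> \<bar>\<rho>' z0\<bar>) (nhds z0)"
      unfolding k_def isCont_def by (auto intro!: tendsto_rabs simp: tendsto_at_iff_tendsto_nhds)
    moreover have "\<forall>\<^sub>F z in nhds z0. z \<in> {-q<..<q}"
      by (rule eventually_nhds_in_open) (use z0 in auto)
    ultimately show ?thesis
      using k by (intro eventually_conj order_tendstoD) (auto simp: N_def)
  qed
  then obtain e where e: "e > 0"
    and near: "\<And>z. dist z z0 < e \<Longrightarrow> z \<in> {-q<..<q} \<and> k / 2 < \<rho> z \<and> \<rho> z < 2 * k \<and> \<bar>\<rho>' z\<bar> < N"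
    unfolding eventually_nhds_metric by blast
  \<comment> \<open>The bound on \<open>r\<close> gives \<open>\<bar>z - \<beta>\<bar> * \<bar>\<rho>' z\<bar> \<le> 2 r N < k / 2 < \<rho> z\<close> for \<open>z\<close> and \<open>\<beta>\<close> within
    \<open>r\<close> of \<open>z0\<close>; the bound on \<open>m\<close> keeps the heights of the loop within \<open>r\<close> of \<open>z0\<close>.\<close>
  define r where "r = min e (k / (8 * N))"
  define m where "m = min (\<mu> / 2) (r / (8 * k))"
  have r: "r > 0" "2 * r * N < k / 2"
  proof -
    show "r > 0"
      using e k N by (simp add: r_def)
    have "r * (8 * N) \<le> k"
      using N by (simp add: r_def min_def field_simps)
    then show "2 * r * N < k / 2"
      using k by (simp add: algebra_simps)
  qed
  have m: "m > 0" "m < \<mu>" "m * (8 * k) \<le> r"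
    using \<mu> r k by (auto simp: m_def min_def field_simps)
  have near_r: "z \<in> {-q<..<q}" "k / 2 < \<rho> z" "\<rho> z < 2 * k" "\<bar>\<rho>' z\<bar> < N"
    if "z0 - r < z" "z < z0 + r" for z
    using near[of z] that by (auto simp: r_def dist_real_def)
  have odd: "\<exists>K. \<forall>t. \<bar>t\<bar> \<le> m * k / 2 \<longrightarrow> F (c + t) - F (c - t) = K * t"
    if c: "z0 - r / 2 < c" "c < z0 + r / 2" for c
  proof -
    \<comment> \<open>The center is prescribed, and the plane is found afterwards.\<close>
    have "\<exists>h\<ge>0. h \<le> r / 2 \<and> 2 * h - m * (\<rho> (c - h) + \<rho> (c + h)) = 0"
    proof (rule IVT')
      show "2 * 0 - m * (\<rho> (c - 0) + \<rho> (c + 0)) \<le> 0"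
        using near_r[of c] c m(1) k r by simp
      have "\<rho> (c - r / 2) < 2 * k" "\<rho> (c + r / 2) < 2 * k"
        using near_r[of "c - r / 2"] near_r[of "c + r / 2"] c by auto
      then have "m * (\<rho> (c - r / 2) + \<rho> (c + r / 2)) \<le> m * (8 * k)"
        using m(1) k by (intro mult_left_mono) auto
      then show "0 \<le> 2 * (r / 2) - m * (\<rho> (c - r / 2) + \<rho> (c + r / 2))"
        using m(3) by simp
      show "continuous_on {0..r / 2} (\<lambda>h. 2 * h - m * (\<rho> (c - h) + \<rho> (c + h)))"
        by (intro continuous_intros continuous_on_compose2[OF \<rho>cont])
           (use c near_r(1) in fastforce)+
    qed (use r in auto)
    then obtain h where h: "0 \<le> h" "h \<le> r / 2" "m * \<rho> (c - h) + m * \<rho> (c + h) = 2 * h"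
      by (auto simp: distrib_left)
    have ch: "z0 - r < c - h" "c - h < z0 + r" "z0 - r < c + h" "c + h < z0 + r"
      using c h by linarith+
    have "m * (k / 2) < m * \<rho> (c - h)" "m * (k / 2) < m * \<rho> (c + h)"
      using near_r(2)[OF ch(1,2)] near_r(2)[OF ch(3,4)] m(1) by simp_all
    moreover have "m * k > 0"
      using m(1) k by simp
    ultimately have hk: "m * k / 2 < h" "0 < m * \<rho> (c - h)" "0 < m * \<rho> (c + h)"
      using h(3) by auto
    define \<beta> where "\<beta> = c - h + m * \<rho> (c - h)"
    have \<beta>: "c + h - m * \<rho> (c + h) = \<beta>"
      using h(3) by (simp add: \<beta>_def)
    let ?L = "capped_section q F m \<beta> (c - h) (c + h)"
    have L: "cuts_in_loop (plane m 0 \<beta>) (revolution_locus q F) ?L"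
    proof (rule capped_section_is_loop[where a = "z0 - r" and b = "z0 + r" and \<rho> = \<rho> and \<rho>' = \<rho>'])
      fix z assume z: "z0 - r < z" "z < z0 + r"
      note zn = near_r[OF z]
      show "(\<rho> has_real_derivative \<rho>' z) (at z)" "0 < \<rho> z" "F z = (\<rho> z)\<^sup>2 \<and> \<bar>z\<bar> < q"
        using d\<rho>[OF zn(1)] \<rho>pos[OF zn(1)] \<rho>sq[OF zn(1)] zn(1) by auto
      have "\<bar>z - \<beta>\<bar> \<le> 2 * r"
        using z ch \<beta> hk by (simp add: \<beta>_def)
      then have "\<bar>z - \<beta>\<bar> * \<bar>\<rho>' z\<bar> \<le> 2 * r * N"
        using zn(4) r by (intro mult_mono) auto
      moreover have "(z - \<beta>) * \<rho>' z \<le> \<bar>z - \<beta>\<bar> * \<bar>\<rho>' z\<bar>"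
        unfolding abs_mult[symmetric] by simp
      ultimately show "(z - \<beta>) * \<rho>' z < \<rho> z"
        using r(2) zn(2) by linarith
    next
      show "continuous_on {z0 - r<..<z0 + r} \<rho>'"
        by (rule continuous_on_subset[OF \<rho>'cont]) (use near_r(1) in auto)
    qed (use m ch hk \<open>0 < m * k\<close> \<beta> in \<open>auto simp: \<beta>_def\<close>)
    have sq: "F (c - h) = (\<rho> (c - h))\<^sup>2" "F (c + h) = (\<rho> (c + h))\<^sup>2"
      using \<rho>sq near_r(1) ch by simp_all
    have "F (c + t) - F (c - t) = 4 * (c - \<beta>) / m\<^sup>2 * t" if "\<bar>t\<bar> \<le> m * k / 2" for t
    proof (rule central_capped_section_reflection[where h = h])
      show "central ?L"
        using central[OF m(1,2) L] .
      show "connected ?L"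
        using L in_components_connected unfolding cuts_in_loop_def by blast
      show "\<bar>c - h\<bar> < q" "\<bar>c + h\<bar> < q"
        using near_r(1)[OF ch(1,2)] near_r(1)[OF ch(3,4)] by auto
      have "c - h - \<beta> = - (m * \<rho> (c - h))" "c + h - \<beta> = m * \<rho> (c + h)"
        using \<beta> by (auto simp: \<beta>_def)
      then show "(c - h - \<beta>)\<^sup>2 = m\<^sup>2 * F (c - h)" "(c + h - \<beta>)\<^sup>2 = m\<^sup>2 * F (c + h)"
        by (simp_all add: sq power_mult_distrib)
    qed (use m h hk that in auto)
    then show ?thesis
      by blast
  qed
  \<comment> \<open>Inside an interval of radius \<open>s\<close> every admissible \<open>t\<close> satisfies \<open>\<bar>t\<bar> \<le> m * k / 2\<close>.\<close>
  define s where "s = min (r / 2) (m * k / 2)"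
  have s: "s > 0" "s \<le> r / 2" "s \<le> m * k / 2"
    using r m k by (auto simp: s_def)
  obtain A B C where ABC: "\<And>z. z0 - s / 2 < z \<Longrightarrow> z < z0 + s \<Longrightarrow> F z = A * z\<^sup>2 + B * z + C"
  proof (rule quadratic_if_odd_parts_linear)
    show "(F has_real_derivative F' z) (at z)" if "z0 - s < z" "z < z0 + s" for z
      using F' near_r(1)[of z] that s r by auto
    show "\<exists>K. \<forall>t. 0 \<le> t \<longrightarrow> z0 - s < c - t \<longrightarrow> c + t < z0 + s \<longrightarrow> F (c + t) - F (c - t) = K * t"
      if c: "z0 - s < c" "c < z0 + s" for c
    proof -
      obtain K where "\<forall>t. \<bar>t\<bar> \<le> m * k / 2 \<longrightarrow> F (c + t) - F (c - t) = K * t"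
        using odd[of c] c s by auto
      then show ?thesis
        using s by (intro exI[of _ K]) auto
    qed
  qed (use s in auto)
  have "\<forall>\<^sub>F z in nhds z0. z \<in> {z0 - s / 2<..<z0 + s}"
    by (rule eventually_nhds_in_open) (use s in auto)
  then have "\<forall>\<^sub>F z in nhds z0. F z = A * z\<^sup>2 + B * z + C"
    by eventually_elim (use ABC in auto)
  then show ?thesis
    by blast
qed

theorem theorem1p1:
  fixes S :: "(real^3) set" and \<mu> :: real
  assumes "C1_surface_of_revolution_in_standard_position S"
    and "\<mu> > 0"
    and "\<And>m1 m2 \<beta> L. \<lbrakk>slope m1 m2 < \<mu>; cuts_in_loop (plane m1 m2 \<beta>) S L\<rbrakk> \<Longrightarrow> central L"
  shows "quadric S"
proof -
  obtain q F where profile: "C1_profile q F" and S: "S = revolution_locus q F"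
    using assms(1) unfolding C1_surface_of_revolution_in_standard_position_def by blast
  have central: "central L"
    if "0 < m" "m < \<mu>" "cuts_in_loop (plane m 0 \<beta>) (revolution_locus q F) L" for m \<beta> L
    using assms(3)[of m 0 \<beta> L] that S by (simp add: slope_def)
  obtain a b c where F: "\<And>z. z \<in> {-q<..<q} \<Longrightarrow> F z = a * z\<^sup>2 + b * z + c"
  proof (rule locally_quadratic_imp_quadratic[of "{-q<..<q}" F])
    show "\<exists>A B C. \<forall>\<^sub>F z in nhds z0. F z = A * z\<^sup>2 + B * z + C" if "z0 \<in> {-q<..<q}" for z0
      by (rule central_sections_imp_locally_quadratic[OF profile assms(2) central that])
  qed auto
  let ?Q = "\<lambda>z. a * z\<^sup>2 + b * z + c"
  have "?Q C1_differentiable_on {-q<..<q}"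
    by (simp add: power2_eq_square)
  then have "C1_profile q ?Q"
    using profile F unfolding C1_profile_def by auto
  moreover have "S = revolution_locus q ?Q"
    using F unfolding S revolution_locus_def by (auto simp: abs_less_iff)
  ultimately show ?thesis
    unfolding quadric_def by blast
qed

end
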